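(* Let $E$ be a finite field and let $A$ be a non-trivial inverse-closed additive subgroup of $E$. Then either $A$ is a subfield of $E$, or $A$ is the set of elements of trace zero in some quadratic field extension contained in $E$; that is, in the latter case there are subfields $K\subseteq L\subseteq E$ with $[L:K]=2$ such that $A=\{x\in L \mid \mathrm{Tr}_{L/K}(x)=0\}$.
   Context: For a subset $S$ of a field $E$, write $S^{-1}=\{s^{-1}\mid 0\neq s\in S\}$. The subset $S$ is called inverse-closed if $S^{-1}\subseteq S$. An additive subgroup is non-trivial if it is not $\{0\}$. $\mathrm{Tr}_{L/K}$ denotes the trace map of the field extension $L/K$. The characteristic of $E$ is arbitrary (two is allowed). *)

theory Defs
  imports "HOL-Algebra.Algebra"
begin

definition inverse_closed :: "('a, 'b) ring_scheme \<Rightarrow> 'a set \<Rightarrow> bool"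
  where "inverse_closed E S \<longleftrightarrow> {inv\<^bsub>E\<^esub> s | s. s \<in> S \<and> s \<noteq> \<zero>\<^bsub>E\<^esub>} \<subseteq> S"

context ring
begin

(* Us is a K-basis of L, and M is the matrix over K of the map y \<mapsto> x \<otimes> y on L in that basis:
   column j holds the coordinates of x \<otimes> Us ! j. *)
definition mult_matrix :: "'a set \<Rightarrow> 'a set \<Rightarrow> 'a \<Rightarrow> 'a list \<Rightarrow> (nat \<Rightarrow> nat \<Rightarrow> 'a) \<Rightarrow> bool"
  where "mult_matrix K L x Us M \<longleftrightarrow>
    independent K Us \<and> Span K Us = L \<and>
    (\<forall>i<length Us. \<forall>j<length Us. M i j \<in> K) \<and>
    (\<forall>j<length Us. x \<otimes> Us ! j = (\<Oplus>i\<in>{..<length Us}. M i j \<otimes> Us ! i))"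

(* Meaningful when L is a finite extension of the subfield K and x is in L. The value does not
   depend on the basis; see field_trace_eq below. *)
definition field_trace :: "'a set \<Rightarrow> 'a set \<Rightarrow> 'a \<Rightarrow> 'a"
  where "field_trace K L x =
    (THE t. \<exists>Us M. mult_matrix K L x Us M \<and> t = (\<Oplus>i\<in>{..<length Us}. M i i))"

lemma combine_eq_finsum:
  assumes "set Us \<subseteq> carrier R" "\<And>i. i < length Us \<Longrightarrow> f i \<in> carrier R"
  shows "combine (map f [0..<length Us]) Us = (\<Oplus>i\<in>{..<length Us}. f i \<otimes> Us ! i)"
  using assms
proof (induction Us arbitrary: f)
  case Nil
  then show ?case by simp
next
  case (Cons u Us)
  let ?g = "\<lambda>i. f i \<otimes> (u # Us) ! i"
  have g: "?g \<in> {..length Us} \<rightarrow> carrier R"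
  proof
    fix i assume "i \<in> {..length Us}"
    then have i: "i < length (u # Us)" by auto
    then have "(u # Us) ! i \<in> carrier R" using Cons.prems(1) nth_mem by blast
    then show "?g i \<in> carrier R" using Cons.prems(2)[OF i] by simp
  qed
  have IH: "combine (map (\<lambda>i. f (Suc i)) [0..<length Us]) Us
      = (\<Oplus>i\<in>{..<length Us}. f (Suc i) \<otimes> Us ! i)"
    using Cons.prems by (intro Cons.IH) auto
  have split: "map f [0..<length (u # Us)] = f 0 # map (\<lambda>i. f (Suc i)) [0..<length Us]"
    by (simp add: map_upt_Suc del: upt_Suc)
  have c: "(\<Oplus>i\<in>{..<length Us}. f (Suc i) \<otimes> Us ! i) \<in> carrier R"
    using Cons.prems by (intro finsum_closed) (auto simp: Pi_iff subset_iff)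
  have "(\<Oplus>i\<in>{..<length (u # Us)}. ?g i) = (\<Oplus>i\<in>{..<length Us}. f (Suc i) \<otimes> Us ! i) \<oplus> f 0 \<otimes> u"
  proof (cases "length Us")
    case 0
    then show ?thesis using g by (simp add: finsum_Suc Pi_iff lessThan_Suc)
  next
    case (Suc m)
    then show ?thesis
      using finsum_Suc2[of ?g m] g by (simp add: lessThan_Suc_atMost finsum_0)
  qed
  also have "\<dots> = f 0 \<otimes> u \<oplus> (\<Oplus>i\<in>{..<length Us}. f (Suc i) \<otimes> Us ! i)"
    using c Cons.prems by (intro a_comm) auto
  finally show ?case unfolding split using IH by simp
qed

lemma finsum_swap:
  assumes "finite A" "finite B" "\<And>i j. i \<in> A \<Longrightarrow> j \<in> B \<Longrightarrow> f i j \<in> carrier R"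
  shows "(\<Oplus>i\<in>A. \<Oplus>j\<in>B. f i j) = (\<Oplus>j\<in>B. \<Oplus>i\<in>A. f i j)"
  using assms(1,3)
proof (induction A rule: finite_induct)
  case empty
  then show ?case by simp
next
  case (insert a A)
  have "(\<Oplus>j\<in>B. \<Oplus>i\<in>insert a A. f i j) = (\<Oplus>j\<in>B. f a j \<oplus> (\<Oplus>i\<in>A. f i j))"
    using insert by (intro finsum_cong') (auto simp: finsum_insert Pi_iff intro!: finsum_closed)
  also have "\<dots> = (\<Oplus>j\<in>B. f a j) \<oplus> (\<Oplus>j\<in>B. \<Oplus>i\<in>A. f i j)"
    using insert by (intro finsum_addf) (auto simp: Pi_iff intro!: finsum_closed)
  finally show ?case
    using insert by (subst finsum_insert) (auto simp: Pi_iff intro!: finsum_closed)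
qed

end

context field
begin

lemma coordinates_unique:
  assumes K: "subfield K R" and ind: "independent K Us"
    and a: "\<And>i. i < length Us \<Longrightarrow> a i \<in> K" and b: "\<And>i. i < length Us \<Longrightarrow> b i \<in> K"
    and eq: "(\<Oplus>i\<in>{..<length Us}. a i \<otimes> Us ! i) = (\<Oplus>i\<in>{..<length Us}. b i \<otimes> Us ! i)"
    and i: "i < length Us"
  shows "a i = b i"
proof -
  have Us: "set Us \<subseteq> carrier R" using independent_in_carrier[OF ind] .
  have Kc: "K \<subseteq> carrier R" using subfieldE(3)[OF K] .
  let ?A = "map a [0..<length Us]" and ?B = "map b [0..<length Us]"
  have "combine ?A Us = (\<Oplus>i\<in>{..<length Us}. a i \<otimes> Us ! i)"
    using a Kc by (intro combine_eq_finsum[OF Us]) auto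
  moreover have "combine ?B Us = (\<Oplus>i\<in>{..<length Us}. b i \<otimes> Us ! i)"
    using b Kc by (intro combine_eq_finsum[OF Us]) auto
  ultimately have eq': "combine ?A Us = combine ?B Us" using eq by argo
  have A: "set ?A \<subseteq> K" and B: "set ?B \<subseteq> K" using a b by auto
  have "combine ?A Us \<in> Span K Us"
    unfolding Span_mem_iff_length_version[OF K Us] using A by (intro exI[of _ ?A]) simp
  then have "\<exists>!Ks. set Ks \<subseteq> K \<and> length Ks = length Us \<and> combine ?A Us = combine Ks Us"
    using unique_decomposition[OF K ind] by blast
  moreover have "length ?A = length Us" "length ?B = length Us" by simp_all
  ultimately have "?A = ?B"
    using A B eq' by (elim ex1E) (metis (no_types))
  then show ?thesis using i by simp
qed

lemma coordinates_exist:
  assumes K: "subfield K R" and ind: "independent K Us" and v: "v \<in> Span K Us"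
  shows "\<exists>a. (\<forall>i<length Us. a i \<in> K) \<and> v = (\<Oplus>i\<in>{..<length Us}. a i \<otimes> Us ! i)"
proof -
  have Us: "set Us \<subseteq> carrier R" using independent_in_carrier[OF ind] .
  have Kc: "K \<subseteq> carrier R" using subfieldE(3)[OF K] .
  obtain Ks where Ks: "set Ks \<subseteq> K" "length Ks = length Us" "v = combine Ks Us"
    using v Span_mem_iff_length_version[OF K Us] by blast
  have mem: "\<And>i. i < length Us \<Longrightarrow> Ks ! i \<in> K" using Ks by auto
  have "Ks = map (\<lambda>i. Ks ! i) [0..<length Us]"
    using Ks(2) by (metis map_nth)
  then have "v = combine (map (\<lambda>i. Ks ! i) [0..<length Us]) Us" using Ks(3) by simp
  also have "\<dots> = (\<Oplus>i\<in>{..<length Us}. Ks ! i \<otimes> Us ! i)"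
    using mem Kc by (intro combine_eq_finsum[OF Us]) auto
  finally show ?thesis using mem by blast
qed

lemma finsum_mult_assoc:
  fixes m n :: nat
  assumes "\<And>i k. i < n \<Longrightarrow> k < m \<Longrightarrow> A i k \<in> carrier R" "\<And>k. k < m \<Longrightarrow> p k \<in> carrier R"
    and "\<And>i. i < n \<Longrightarrow> u i \<in> carrier R"
  shows "(\<Oplus>k\<in>{..<m}. p k \<otimes> (\<Oplus>i\<in>{..<n}. A i k \<otimes> u i))
       = (\<Oplus>i\<in>{..<n}. (\<Oplus>k\<in>{..<m}. A i k \<otimes> p k) \<otimes> u i)"
proof -
  have "(\<Oplus>k\<in>{..<m}. p k \<otimes> (\<Oplus>i\<in>{..<n}. A i k \<otimes> u i))
      = (\<Oplus>k\<in>{..<m}. \<Oplus>i\<in>{..<n}. A i k \<otimes> p k \<otimes> u i)"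
  proof (rule finsum_cong')
    fix k assume "k \<in> {..<m}"
    then have k: "k < m" by simp
    have "p k \<otimes> (\<Oplus>i\<in>{..<n}. A i k \<otimes> u i) = (\<Oplus>i\<in>{..<n}. p k \<otimes> (A i k \<otimes> u i))"
      using assms k by (intro finsum_rdistr) (auto simp: Pi_iff)
    also have "\<dots> = (\<Oplus>i\<in>{..<n}. A i k \<otimes> p k \<otimes> u i)"
      using assms k by (intro finsum_cong') (auto simp: Pi_iff m_ac)
    finally show "p k \<otimes> (\<Oplus>i\<in>{..<n}. A i k \<otimes> u i) = (\<Oplus>i\<in>{..<n}. A i k \<otimes> p k \<otimes> u i)" .
  qed (use assms in \<open>auto simp: Pi_iff intro!: finsum_closed\<close>)
  also have "\<dots> = (\<Oplus>i\<in>{..<n}. \<Oplus>k\<in>{..<m}. A i k \<otimes> p k \<otimes> u i)"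
    using assms by (intro finsum_swap) auto
  also have "\<dots> = (\<Oplus>i\<in>{..<n}. (\<Oplus>k\<in>{..<m}. A i k \<otimes> p k) \<otimes> u i)"
    using assms
    by (intro finsum_cong') (auto simp: Pi_iff finsum_ldistr intro!: finsum_closed)
  finally show ?thesis .
qed

lemma trace_basis_independent:
  assumes K: "subfield K R" and x: "x \<in> carrier R"
    and M: "mult_matrix K L x Us M" and N: "mult_matrix K L x Vs N"
  shows "(\<Oplus>i\<in>{..<length Us}. M i i) = (\<Oplus>i\<in>{..<length Vs}. N i i)"
proof -
  let ?m = "length Us" and ?n = "length Vs"
  have Kc: "K \<subseteq> carrier R" using subfieldE(3)[OF K] .
  have Ksub: "subring K R" using subfieldE(1)[OF K] .
  have indU: "independent K Us" and SU: "Span K Us = L"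
    and MK: "\<And>i j. i < ?m \<Longrightarrow> j < ?m \<Longrightarrow> M i j \<in> K"
    and Mx: "\<And>j. j < ?m \<Longrightarrow> x \<otimes> Us ! j = (\<Oplus>i\<in>{..<?m}. M i j \<otimes> Us ! i)"
    using M unfolding mult_matrix_def by auto
  have indV: "independent K Vs" and SV: "Span K Vs = L"
    and NK: "\<And>i j. i < ?n \<Longrightarrow> j < ?n \<Longrightarrow> N i j \<in> K"
    and Nx: "\<And>j. j < ?n \<Longrightarrow> x \<otimes> Vs ! j = (\<Oplus>i\<in>{..<?n}. N i j \<otimes> Vs ! i)"
    using N unfolding mult_matrix_def by auto
  have Uc: "\<And>i. i < ?m \<Longrightarrow> Us ! i \<in> carrier R"
    using independent_in_carrier[OF indU] by auto
  have Vc: "\<And>i. i < ?n \<Longrightarrow> Vs ! i \<in> carrier R"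
    using independent_in_carrier[OF indV] by auto
  have UL: "\<And>i. i < ?m \<Longrightarrow> Us ! i \<in> Span K Vs"
    using Span_base_incl[OF K independent_in_carrier[OF indU]] SU SV by auto
  have VL: "\<And>i. i < ?n \<Longrightarrow> Vs ! i \<in> Span K Us"
    using Span_base_incl[OF K independent_in_carrier[OF indV]] SU SV by auto
  have "\<forall>j. j < ?n \<longrightarrow> (\<exists>a. (\<forall>i<?m. a i \<in> K) \<and> Vs ! j = (\<Oplus>i\<in>{..<?m}. a i \<otimes> Us ! i))"
    using coordinates_exist[OF K indU VL] by blast
  then obtain p where p: "\<forall>j. j < ?n \<longrightarrow> (\<forall>i<?m. p j i \<in> K) \<and>
      Vs ! j = (\<Oplus>i\<in>{..<?m}. p j i \<otimes> Us ! i)"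
    by metis
  have "\<forall>j. j < ?m \<longrightarrow> (\<exists>a. (\<forall>i<?n. a i \<in> K) \<and> Us ! j = (\<Oplus>i\<in>{..<?n}. a i \<otimes> Vs ! i))"
    using coordinates_exist[OF K indV UL] by blast
  then obtain q where q: "\<forall>j. j < ?m \<longrightarrow> (\<forall>i<?n. q j i \<in> K) \<and>
      Us ! j = (\<Oplus>i\<in>{..<?n}. q j i \<otimes> Vs ! i)"
    by metis
  have pK: "\<And>i j. i < ?m \<Longrightarrow> j < ?n \<Longrightarrow> p j i \<in> K"
    and V: "\<And>j. j < ?n \<Longrightarrow> Vs ! j = (\<Oplus>i\<in>{..<?m}. p j i \<otimes> Us ! i)" using p by auto
  have qK: "\<And>i j. i < ?n \<Longrightarrow> j < ?m \<Longrightarrow> q j i \<in> K"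
    and U: "\<And>j. j < ?m \<Longrightarrow> Us ! j = (\<Oplus>i\<in>{..<?n}. q j i \<otimes> Vs ! i)" using q by auto
  note c = subsetD[OF Kc MK] subsetD[OF Kc NK] subsetD[OF Kc pK] subsetD[OF Kc qK] Uc Vc
  have sumK: "(\<Oplus>i\<in>{..<k::nat}. f i) \<in> K" if "\<And>i. i < k \<Longrightarrow> f i \<in> K" for f k
    using that
  proof (induction k)
    case 0
    then show ?case using subringE(2)[OF Ksub] by simp
  next
    case (Suc k)
    then have "(\<Oplus>i\<in>{..<Suc k}. f i) = f k \<oplus> (\<Oplus>i\<in>{..<k}. f i)"
      using Kc by (subst lessThan_Suc, subst finsum_insert) (auto simp: Pi_iff subset_iff)
    then show ?case using Suc subringE(7)[OF Ksub] by auto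
  qed
  have mulK: "\<And>a b. a \<in> K \<Longrightarrow> b \<in> K \<Longrightarrow> a \<otimes> b \<in> K" using subringE(6)[OF Ksub] .
  have MP: "(\<Oplus>k\<in>{..<?m}. M i k \<otimes> p j k) = (\<Oplus>k\<in>{..<?n}. p k i \<otimes> N k j)"
    if i: "i < ?m" and j: "j < ?n" for i j
  proof (rule coordinates_unique[OF K indU _ _ _ i])
    have "x \<otimes> Vs ! j = (\<Oplus>k\<in>{..<?m}. x \<otimes> (p j k \<otimes> Us ! k))"
      using c j x by (subst V[OF j], intro finsum_rdistr) (auto simp: Pi_iff)
    also have "\<dots> = (\<Oplus>k\<in>{..<?m}. p j k \<otimes> (\<Oplus>i\<in>{..<?m}. M i k \<otimes> Us ! i))"
      using c j x
      by (intro finsum_cong') (auto simp: Pi_iff Mx[symmetric] m_ac intro!: finsum_closed)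
    also have "\<dots> = (\<Oplus>i\<in>{..<?m}. (\<Oplus>k\<in>{..<?m}. M i k \<otimes> p j k) \<otimes> Us ! i)"
      using c j by (intro finsum_mult_assoc) auto
    finally have 1: "x \<otimes> Vs ! j = (\<Oplus>i\<in>{..<?m}. (\<Oplus>k\<in>{..<?m}. M i k \<otimes> p j k) \<otimes> Us ! i)" .
    have "x \<otimes> Vs ! j = (\<Oplus>k\<in>{..<?n}. N k j \<otimes> (\<Oplus>i\<in>{..<?m}. p k i \<otimes> Us ! i))"
      unfolding Nx[OF j] using c j
      by (intro finsum_cong') (auto simp: Pi_iff V[symmetric])
    also have "\<dots> = (\<Oplus>i\<in>{..<?m}. (\<Oplus>k\<in>{..<?n}. p k i \<otimes> N k j) \<otimes> Us ! i)"
      using c j by (intro finsum_mult_assoc) auto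
    finally show "(\<Oplus>i\<in>{..<?m}. (\<Oplus>k\<in>{..<?m}. M i k \<otimes> p j k) \<otimes> Us ! i)
        = (\<Oplus>i\<in>{..<?m}. (\<Oplus>k\<in>{..<?n}. p k i \<otimes> N k j) \<otimes> Us ! i)"
      using 1 by simp
  qed (use MK NK pK j in \<open>auto intro!: sumK mulK\<close>)
  have PQ: "(\<Oplus>k\<in>{..<?n}. p k i \<otimes> q j k) = (if i = j then \<one> else \<zero>)"
    if i: "i < ?m" and j: "j < ?m" for i j
  proof (rule coordinates_unique[OF K indU _ _ _ i])
    have "Us ! j = (\<Oplus>k\<in>{..<?n}. q j k \<otimes> (\<Oplus>i\<in>{..<?m}. p k i \<otimes> Us ! i))"
      by (subst U[OF j]) (use c j in \<open>auto intro!: finsum_cong' simp: Pi_iff V[symmetric]\<close>)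
    also have "\<dots> = (\<Oplus>i\<in>{..<?m}. (\<Oplus>k\<in>{..<?n}. p k i \<otimes> q j k) \<otimes> Us ! i)"
      using c j by (intro finsum_mult_assoc) auto
    finally have 1: "Us ! j = (\<Oplus>i\<in>{..<?m}. (\<Oplus>k\<in>{..<?n}. p k i \<otimes> q j k) \<otimes> Us ! i)" .
    have "(\<Oplus>i\<in>{..<?m}. (if i = j then \<one> else \<zero>) \<otimes> Us ! i)
        = (\<Oplus>i\<in>{..<?m}. if j = i then Us ! i else \<zero>)"
      using Uc by (intro finsum_cong') (auto simp: Pi_iff)
    also have "\<dots> = Us ! j"
      using j Uc finsum_singleton[of j "{..<?m}" "\<lambda>i. Us ! i"] by (auto simp: Pi_iff)
    finally show "(\<Oplus>i\<in>{..<?m}. (\<Oplus>k\<in>{..<?n}. p k i \<otimes> q j k) \<otimes> Us ! i)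
        = (\<Oplus>i\<in>{..<?m}. (if i = j then \<one> else \<zero>) \<otimes> Us ! i)"
      using 1 by simp
  qed (use pK qK j subringE(2,3)[OF Ksub] in \<open>auto intro!: sumK mulK\<close>)
  have QP: "(\<Oplus>k\<in>{..<?m}. q k i \<otimes> p j k) = (if i = j then \<one> else \<zero>)"
    if i: "i < ?n" and j: "j < ?n" for i j
  proof (rule coordinates_unique[OF K indV _ _ _ i])
    have "Vs ! j = (\<Oplus>k\<in>{..<?m}. p j k \<otimes> (\<Oplus>i\<in>{..<?n}. q k i \<otimes> Vs ! i))"
      by (subst V[OF j]) (use c j in \<open>auto intro!: finsum_cong' simp: Pi_iff U[symmetric]\<close>)
    also have "\<dots> = (\<Oplus>i\<in>{..<?n}. (\<Oplus>k\<in>{..<?m}. q k i \<otimes> p j k) \<otimes> Vs ! i)"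
      using c j by (intro finsum_mult_assoc) auto
    finally have 1: "Vs ! j = (\<Oplus>i\<in>{..<?n}. (\<Oplus>k\<in>{..<?m}. q k i \<otimes> p j k) \<otimes> Vs ! i)" .
    have "(\<Oplus>i\<in>{..<?n}. (if i = j then \<one> else \<zero>) \<otimes> Vs ! i)
        = (\<Oplus>i\<in>{..<?n}. if j = i then Vs ! i else \<zero>)"
      using Vc by (intro finsum_cong') (auto simp: Pi_iff)
    also have "\<dots> = Vs ! j"
      using j Vc finsum_singleton[of j "{..<?n}" "\<lambda>i. Vs ! i"] by (auto simp: Pi_iff)
    finally show "(\<Oplus>i\<in>{..<?n}. (\<Oplus>k\<in>{..<?m}. q k i \<otimes> p j k) \<otimes> Vs ! i)
        = (\<Oplus>i\<in>{..<?n}. (if i = j then \<one> else \<zero>) \<otimes> Vs ! i)"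
      using 1 by simp
  qed (use pK qK j subringE(2,3)[OF Ksub] in \<open>auto intro!: sumK mulK\<close>)
  define T where "T = (\<Oplus>i\<in>{..<?m}. \<Oplus>k\<in>{..<?n}. (\<Oplus>l\<in>{..<?m}. M i l \<otimes> p k l) \<otimes> q i k)"
  have diagM: "(\<Oplus>k\<in>{..<?n}. (\<Oplus>l\<in>{..<?m}. M i l \<otimes> p k l) \<otimes> q i k) = M i i"
    if i: "i < ?m" for i
  proof -
    have "(\<Oplus>k\<in>{..<?n}. (\<Oplus>l\<in>{..<?m}. M i l \<otimes> p k l) \<otimes> q i k)
        = (\<Oplus>k\<in>{..<?n}. q i k \<otimes> (\<Oplus>l\<in>{..<?m}. p k l \<otimes> M i l))"
    proof (rule finsum_cong')
      fix k assume "k \<in> {..<?n}"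
      then have k: "k < ?n" by simp
      have "(\<Oplus>l\<in>{..<?m}. M i l \<otimes> p k l) = (\<Oplus>l\<in>{..<?m}. p k l \<otimes> M i l)"
        using c i k by (intro finsum_cong') (auto simp: Pi_iff intro!: m_comm)
      moreover have "(\<Oplus>l\<in>{..<?m}. p k l \<otimes> M i l) \<in> carrier R"
        using c i k by (intro finsum_closed) (auto simp: Pi_iff)
      ultimately show "(\<Oplus>l\<in>{..<?m}. M i l \<otimes> p k l) \<otimes> q i k
          = q i k \<otimes> (\<Oplus>l\<in>{..<?m}. p k l \<otimes> M i l)"
        using c i k by (simp add: m_comm)
    qed (use c i in \<open>auto simp: Pi_iff intro!: finsum_closed\<close>)
    also have "\<dots> = (\<Oplus>l\<in>{..<?m}. (\<Oplus>k\<in>{..<?n}. p k l \<otimes> q i k) \<otimes> M i l)"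
      using c i by (intro finsum_mult_assoc) auto
    also have "\<dots> = (\<Oplus>l\<in>{..<?m}. if i = l then M i l else \<zero>)"
      using c i by (intro finsum_cong') (auto simp: Pi_iff PQ)
    also have "\<dots> = M i i"
      using c i finsum_singleton[of i "{..<?m}" "\<lambda>l. M i l"] by (auto simp: Pi_iff)
    finally show ?thesis .
  qed
  have TM: "T = (\<Oplus>i\<in>{..<?m}. M i i)"
    unfolding T_def using c by (intro finsum_cong') (auto simp: diagM)
  have "T = (\<Oplus>i\<in>{..<?m}. \<Oplus>k\<in>{..<?n}. (\<Oplus>l\<in>{..<?n}. p l i \<otimes> N l k) \<otimes> q i k)"
    unfolding T_def using c
    by (intro finsum_cong') (auto simp: MP Pi_iff intro!: finsum_closed finsum_cong')
  also have "\<dots> = (\<Oplus>i\<in>{..<?m}. \<Oplus>l\<in>{..<?n}. \<Oplus>k\<in>{..<?n}. p l i \<otimes> N l k \<otimes> q i k)"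
  proof (rule finsum_cong')
    fix i assume "i \<in> {..<?m}"
    then have i: "i < ?m" by simp
    have "(\<Oplus>k\<in>{..<?n}. (\<Oplus>l\<in>{..<?n}. p l i \<otimes> N l k) \<otimes> q i k)
        = (\<Oplus>k\<in>{..<?n}. \<Oplus>l\<in>{..<?n}. p l i \<otimes> N l k \<otimes> q i k)"
      using c i by (intro finsum_cong') (auto simp: Pi_iff finsum_ldistr intro!: finsum_closed)
    also have "\<dots> = (\<Oplus>l\<in>{..<?n}. \<Oplus>k\<in>{..<?n}. p l i \<otimes> N l k \<otimes> q i k)"
      using c i by (intro finsum_swap) auto
    finally show "(\<Oplus>k\<in>{..<?n}. (\<Oplus>l\<in>{..<?n}. p l i \<otimes> N l k) \<otimes> q i k)
        = (\<Oplus>l\<in>{..<?n}. \<Oplus>k\<in>{..<?n}. p l i \<otimes> N l k \<otimes> q i k)" .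
  qed (use c in \<open>auto simp: Pi_iff intro!: finsum_closed\<close>)
  also have "\<dots> = (\<Oplus>l\<in>{..<?n}. \<Oplus>i\<in>{..<?m}. \<Oplus>k\<in>{..<?n}. p l i \<otimes> N l k \<otimes> q i k)"
    using c by (intro finsum_swap) (auto simp: Pi_iff intro!: finsum_closed)
  also have "\<dots> = (\<Oplus>l\<in>{..<?n}. N l l)"
  proof (rule finsum_cong')
    fix l assume "l \<in> {..<?n}"
    then have l: "l < ?n" by simp
    have "(\<Oplus>i\<in>{..<?m}. \<Oplus>k\<in>{..<?n}. p l i \<otimes> N l k \<otimes> q i k)
        = (\<Oplus>i\<in>{..<?m}. p l i \<otimes> (\<Oplus>k\<in>{..<?n}. q i k \<otimes> N l k))"
    proof (rule finsum_cong')
      fix i assume "i \<in> {..<?m}"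
      then have i: "i < ?m" by simp
      have "p l i \<otimes> (\<Oplus>k\<in>{..<?n}. q i k \<otimes> N l k) = (\<Oplus>k\<in>{..<?n}. p l i \<otimes> (q i k \<otimes> N l k))"
        using c i l by (intro finsum_rdistr) (auto simp: Pi_iff)
      also have "\<dots> = (\<Oplus>k\<in>{..<?n}. p l i \<otimes> N l k \<otimes> q i k)"
        using c i l by (intro finsum_cong') (auto simp: Pi_iff m_ac)
      finally show "(\<Oplus>k\<in>{..<?n}. p l i \<otimes> N l k \<otimes> q i k)
          = p l i \<otimes> (\<Oplus>k\<in>{..<?n}. q i k \<otimes> N l k)" by simp
    qed (use c l in \<open>auto simp: Pi_iff intro!: finsum_closed\<close>)
    also have "\<dots> = (\<Oplus>k\<in>{..<?n}. (\<Oplus>i\<in>{..<?m}. q i k \<otimes> p l i) \<otimes> N l k)"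
      using c l by (intro finsum_mult_assoc) auto
    also have "\<dots> = (\<Oplus>k\<in>{..<?n}. if l = k then N l k else \<zero>)"
      using c l by (intro finsum_cong') (auto simp: Pi_iff QP)
    also have "\<dots> = N l l"
      using c l finsum_singleton[of l "{..<?n}" "\<lambda>k. N l k"] by (auto simp: Pi_iff)
    finally show "(\<Oplus>i\<in>{..<?m}. \<Oplus>k\<in>{..<?n}. p l i \<otimes> N l k \<otimes> q i k) = N l l" .
  qed (use c in \<open>auto simp: Pi_iff\<close>)
  finally show ?thesis using TM by simp
qed

theorem field_trace_eq:
  assumes "subfield K R" "x \<in> carrier R" "mult_matrix K L x Us M"
  shows "field_trace K L x = (\<Oplus>i\<in>{..<length Us}. M i i)"
  unfolding field_trace_def
  using assms trace_basis_independent[OF assms(1,2)] by (intro the_equality) blast+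

lemma mult_matrix_exists:
  assumes K: "subfield K R" and L: "subring L R" and dim: "dimension n K L" and x: "x \<in> L"
  shows "\<exists>Us M. length Us = n \<and> mult_matrix K L x Us M"
proof -
  obtain Us where Us: "set Us \<subseteq> carrier R" "independent K Us" "length Us = n" "Span K Us = L"
    using exists_base[OF K dim] by blast
  have "Us ! j \<in> L" if "j < length Us" for j
    using Span_base_incl[OF K Us(1)] Us(4) that by auto
  then have "x \<otimes> Us ! j \<in> Span K Us" if "j < length Us" for j
    using subringE(6)[OF L x] Us(4) that by auto
  then have "\<forall>j. j < length Us \<longrightarrow> (\<exists>a. (\<forall>i<length Us. a i \<in> K) \<and>
      x \<otimes> Us ! j = (\<Oplus>i\<in>{..<length Us}. a i \<otimes> Us ! i))"
    using coordinates_exist[OF K Us(2)] by blast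
  then obtain c where "\<forall>j. j < length Us \<longrightarrow> (\<forall>i<length Us. c j i \<in> K) \<and>
      x \<otimes> Us ! j = (\<Oplus>i\<in>{..<length Us}. c j i \<otimes> Us ! i)"
    by metis
  then have "mult_matrix K L x Us (\<lambda>i j. c j i)"
    using Us unfolding mult_matrix_def by auto
  then show ?thesis using Us(3) by blast
qed

end

end

theory Submission
  imports Defs
begin

text \<open>
Let \<open>A\<close> be a non-trivial inverse-closed additive subgroup. Hua's identity writes
\<open>a\<^sup>2 b\<close> using only differences, sums and inverses of \<open>a\<close> and \<open>b\<close>, so \<open>a\<^sup>2 b \<in> A\<close> for all
\<open>a, b \<in> A\<close> (lemma \<open>inverse_closed_square_multiplies\<close>). In other words, the square of every
element of \<open>A\<close> lies in the ring \<open>K\<close> of all \<open>r\<close> with \<open>r A \<subseteq> A\<close>. Being a finite subring of a field,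
\<open>K\<close> is a field, and \<open>A\<close> is a vector space over it. The characteristic decides how to exploit this.

In characteristic two, squaring is injective and additive, so the squares of \<open>A\<close> form a subset of
\<open>K\<close> with \<open>|A|\<close> elements. Conversely \<open>r \<mapsto> r a\<close> embeds \<open>K\<close> into \<open>A\<close> for any non-zero \<open>a \<in> A\<close>.
By counting, \<open>K\<close> is exactly the set of squares of \<open>A\<close>, and taking square roots transfers
closure under multiplication from \<open>K\<close> to \<open>A\<close>. Thus \<open>A\<close> is a subfield
(lemma \<open>char_2_subfield\<close>).

In odd characteristic, polarizing the squares and dividing by two gives \<open>x y \<in> K\<close> for all
\<open>x, y \<in> A\<close>. For a fixed non-zero \<open>a \<in> A\<close>, every \<open>x \<in> A\<close> equals \<open>(x a\<^sup>-\<^sup>1) a\<close> with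
\<open>x a\<^sup>-\<^sup>1 \<in> K\<close>, whence \<open>A = K a\<close> (lemma \<open>odd_char_coset\<close>). If \<open>a \<in> K\<close>, then \<open>A = K\<close>. Otherwise
\<open>a\<close> is a square root of an element of \<open>K\<close> lying outside \<open>K\<close>, so \<open>L = K a + K\<close> is a quadratic
extension in which \<open>k a + l\<close> has trace \<open>2 l\<close>, and the elements of trace zero are those of \<open>K a = A\<close>
(lemma \<open>trace_zero_set_square_root\<close>).
\<close>

section \<open>Finite subrings and multiplier rings\<close>

text \<open>Multiplication by a non-zero \<open>k \<in> H\<close> is an injective map from the finite set \<open>H\<close> to itself,
hence surjective; a preimage of \<open>\<one>\<close> is the inverse of \<open>k\<close>.\<close>

lemma (in field) finite_subring_is_subfield:
  assumes H: "subring H R" and fin: "finite H"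
  shows "subfield H R"
proof (rule subfieldI'[OF H])
  fix k assume k: "k \<in> H - {\<zero>}"
  have Hc: "H \<subseteq> carrier R" using subringE(1)[OF H] .
  have kU: "k \<in> Units R" using k Hc field_Units by auto
  have "inj_on ((\<otimes>) k) H"
    using k m_lcancel[of k] subsetD[OF Hc] by (auto intro!: inj_onI)
  moreover have "(\<otimes>) k ` H \<subseteq> H" using k subringE(6)[OF H] by auto
  ultimately have "(\<otimes>) k ` H = H" using endo_inj_surj[OF fin] by blast
  then obtain h where h: "h \<in> H" "k \<otimes> h = \<one>" using subringE(3)[OF H] by (metis imageE)
  then have "inv k = h" using comm_inv_char k Hc by auto
  then show "inv k \<in> H" using h by simp
qed

definition multiplier_ring :: "('a, 'b) ring_scheme \<Rightarrow> 'a set \<Rightarrow> 'a set"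
  where "multiplier_ring R A = {r \<in> carrier R. \<forall>x\<in>A. r \<otimes>\<^bsub>R\<^esub> x \<in> A}"

lemma (in ring) subring_multiplier_ring:
  assumes "additive_subgroup A R"
  shows "subring (multiplier_ring R A) R"
proof -
  interpret A: additive_subgroup A R by fact
  note Ac = subsetD[OF A.a_subset]
  show ?thesis
    unfolding multiplier_ring_def
    by (rule subringI) (auto simp: Ac m_assoc l_distr l_minus)
qed

section \<open>Hua's identity\<close>

text \<open>With \<open>c = b\<^sup>-\<^sup>1 - a\<close> one has \<open>b c = 1 - a b\<close>, and multiplying \<open>a\<^sup>-\<^sup>1 + c\<^sup>-\<^sup>1\<close> by \<open>a b c\<close> gives
\<open>b c + a b = 1\<close>. So the inner sum is invertible with inverse \<open>a b c = a - a\<^sup>2 b\<close>. Non-vanishing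
of that sum is recorded separately because inverse-closedness speaks only of non-zero elements.\<close>

lemma (in field) Hua_identity:
  assumes a: "a \<in> carrier R" "a \<noteq> \<zero>" and b: "b \<in> carrier R" "b \<noteq> \<zero>"
    and c: "inv b \<ominus> a \<noteq> \<zero>"
  shows "inv a \<oplus> inv (inv b \<ominus> a) \<noteq> \<zero>"
    and "a \<ominus> inv (inv a \<oplus> inv (inv b \<ominus> a)) = a \<otimes> a \<otimes> b"
proof -
  define c d where "c = inv b \<ominus> a" and "d = inv c"
  have U: "a \<in> Units R" "b \<in> Units R" using a b field_Units by auto
  note inv = Units_inv_closed[OF U(1)] Units_inv_closed[OF U(2)]
  have cc: "c \<in> carrier R" unfolding c_def using a inv by simp
  then have cU: "c \<in> Units R" using assms(5) field_Units c_def by auto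
  have dc: "d \<in> carrier R" "d \<otimes> c = \<one>" unfolding d_def using cU by auto
  have ia: "inv a \<otimes> a = \<one>" and bi: "b \<otimes> inv b = \<one>" using U by auto
  have bc: "b \<otimes> c = \<one> \<ominus> a \<otimes> b"
    unfolding c_def bi[symmetric] using a b inv by algebra
  have "(inv a \<oplus> d) \<otimes> (a \<otimes> b \<otimes> c) = (inv a \<otimes> a) \<otimes> (b \<otimes> c) \<oplus> (d \<otimes> c) \<otimes> (a \<otimes> b)"
    using a b cc dc(1) inv by algebra
  also have "\<dots> = \<one>" unfolding ia dc(2) bc using a b by algebra
  finally have e: "(inv a \<oplus> d) \<otimes> (a \<otimes> b \<otimes> c) = \<one>" .
  show "inv a \<oplus> inv (inv b \<ominus> a) \<noteq> \<zero>"
    using e a b cc unfolding d_def[symmetric] c_def[symmetric] by auto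
  have "inv (inv a \<oplus> d) = a \<otimes> b \<otimes> c"
    using e a b cc dc inv by (intro comm_inv_char) auto
  then have "a \<ominus> inv (inv a \<oplus> d) = a \<ominus> a \<otimes> (b \<otimes> c)"
    using a b cc by (simp add: m_assoc)
  also have "\<dots> = a \<otimes> a \<otimes> b" unfolding bc using a b by algebra
  finally show "a \<ominus> inv (inv a \<oplus> inv (inv b \<ominus> a)) = a \<otimes> a \<otimes> b"
    unfolding d_def c_def .
qed

text \<open>The left-hand side of Hua's identity is built from operations under which \<open>A\<close> is closed. The
identity degenerates when \<open>a\<close>, \<open>b\<close> or \<open>b\<^sup>-\<^sup>1 - a\<close> vanishes, and then \<open>a\<^sup>2 b\<close> is \<open>0\<close> or \<open>a\<close>.\<close>

lemma (in field) inverse_closed_square_multiplies: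
  assumes "additive_subgroup A R" and ic: "inverse_closed R A"
    and a: "a \<in> A"
  shows "a \<otimes> a \<in> multiplier_ring R A"
proof -
  interpret A: additive_subgroup A R by fact
  note Ac = subsetD[OF A.a_subset]
  have inv_mem: "inv s \<in> A" if "s \<in> A" "s \<noteq> \<zero>" for s
    using ic that unfolding inverse_closed_def by blast
  have minus_mem: "s \<ominus> t \<in> A" if "s \<in> A" "t \<in> A" for s t
    using that unfolding a_minus_def by auto
  have "a \<otimes> a \<otimes> b \<in> A" if b: "b \<in> A" for b
  proof (cases "a = \<zero> \<or> b = \<zero>")
    case True
    then show ?thesis using Ac a b by auto
  next
    case False
    then have nz: "a \<noteq> \<zero>" "b \<noteq> \<zero>" by auto
    have ib: "inv b \<in> A" "inv a \<in> A" using inv_mem a b nz by auto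
    show ?thesis
    proof (cases "inv b \<ominus> a = \<zero>")
      case True
      \<comment> \<open>Here \<open>a b = 1\<close>, so \<open>a\<^sup>2 b = a\<close>.\<close>
      then have "inv b = a" using Ac ib a by (metis r_right_minus_eq)
      moreover have "inv b \<otimes> b = \<one>" using b nz Ac field_Units by (intro Units_l_inv) auto
      ultimately have "a \<otimes> b = \<one>" by simp
      then show ?thesis using a b Ac by (simp add: m_assoc)
    next
      case False
      note hua = Hua_identity[OF Ac[OF a] nz(1) Ac[OF b] nz(2) False]
      have "inv (inv b \<ominus> a) \<in> A" using inv_mem[OF minus_mem[OF ib(1) a] False] .
      then have "inv (inv a \<oplus> inv (inv b \<ominus> a)) \<in> A" using inv_mem hua(1) ib(2) by blast
      then show ?thesis using minus_mem[OF a] hua(2) by metis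
    qed
  qed
  then show ?thesis unfolding multiplier_ring_def using Ac a by auto
qed

section \<open>Quadratic extensions by a square root\<close>

lemma (in field) Span_pair:
  assumes "subfield K R" "a \<in> carrier R"
  shows "Span K [a, \<one>] = {k \<otimes> a \<oplus> l | k l. k \<in> K \<and> l \<in> K}"
proof -
  have "l \<otimes> \<one> \<oplus> \<zero> = l" if "l \<in> K" for l
    using that subfieldE(3)[OF assms(1)] by auto
  then have "v \<in> Span K [\<one>] \<longleftrightarrow> v \<in> K" for v
    by (auto simp: line_extension_mem_iff)
  then have "u \<in> Span K [a, \<one>] \<longleftrightarrow> (\<exists>k\<in>K. \<exists>l\<in>K. u = k \<otimes> a \<oplus> l)" for u
    by (simp add: line_extension_mem_iff Bex_def)
  then show ?thesis by blast
qed

lemma (in field) independent_pair: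
  assumes K: "subfield K R" and a: "a \<in> carrier R" "a \<notin> K"
  shows "independent K [a, \<one>]"
proof -
  have Kc: "K \<subseteq> carrier R" using subfieldE(3)[OF K] .
  have "a \<notin> Span K [\<one>]" using a(2) Kc by (auto simp: line_extension_mem_iff)
  then show ?thesis using a by (intro li_Cons) auto
qed

text \<open>The product of \<open>k a + l\<close> and \<open>m a + n\<close> is \<open>(k n + l m) a + (k m a\<^sup>2 + l n)\<close>, whose coefficients
lie in \<open>K\<close> because \<open>a\<^sup>2\<close> does.\<close>

lemma (in field) subring_Span_square_root:
  assumes K: "subfield K R" and a: "a \<in> carrier R" and sq: "a \<otimes> a \<in> K"
  shows "subring (Span K [a, \<one>]) R"
proof -
  have Kc: "\<And>k. k \<in> K \<Longrightarrow> k \<in> carrier R" using subfieldE(3)[OF K] by blast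
  note Kr = subringE[OF subfieldE(1)[OF K]]
  have ac: "set [a, \<one>] \<subseteq> carrier R" using a by simp
  show ?thesis
  proof (rule subringI)
    show "Span K [a, \<one>] \<subseteq> carrier R"
      using Span_in_carrier[OF subfieldE(3)[OF K] ac] .
    show "\<one> \<in> Span K [a, \<one>]" using Span_base_incl[OF K ac] by auto
    fix u assume "u \<in> Span K [a, \<one>]"
    then obtain k l where u: "k \<in> K" "l \<in> K" "u = k \<otimes> a \<oplus> l"
      unfolding Span_pair[OF K a] by blast
    have "\<ominus> u = (\<ominus> k) \<otimes> a \<oplus> (\<ominus> l)" unfolding u(3) using u(1,2) Kc a by algebra
    then show "\<ominus> u \<in> Span K [a, \<one>]"
      unfolding Span_pair[OF K a] using u(1,2) Kr(5) by blast
    fix v assume "v \<in> Span K [a, \<one>]"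
    then obtain m n where v: "m \<in> K" "n \<in> K" "v = m \<otimes> a \<oplus> n"
      unfolding Span_pair[OF K a] by blast
    have c: "k \<in> carrier R" "l \<in> carrier R" "m \<in> carrier R" "n \<in> carrier R"
      using u v Kc by auto
    have "u \<oplus> v = (k \<oplus> m) \<otimes> a \<oplus> (l \<oplus> n)" unfolding u(3) v(3) using c a by algebra
    then show "u \<oplus> v \<in> Span K [a, \<one>]"
      unfolding Span_pair[OF K a] using u(1,2) v(1,2) Kr(7) by blast
    have "u \<otimes> v = (k \<otimes> n \<oplus> l \<otimes> m) \<otimes> a \<oplus> (k \<otimes> m \<otimes> (a \<otimes> a) \<oplus> l \<otimes> n)"
      unfolding u(3) v(3) using c a by algebra
    moreover have "k \<otimes> n \<oplus> l \<otimes> m \<in> K" "k \<otimes> m \<otimes> (a \<otimes> a) \<oplus> l \<otimes> n \<in> K"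
      using u(1,2) v(1,2) sq Kr(6,7) by auto
    ultimately show "u \<otimes> v \<in> Span K [a, \<one>]"
      unfolding Span_pair[OF K a] by blast
  qed
qed

text \<open>In the basis \<open>a, 1\<close>, multiplication by \<open>k a + l\<close> sends \<open>a\<close> to \<open>l a + k a\<^sup>2\<close> and \<open>1\<close> to
\<open>k a + l\<close>, so both diagonal entries of its matrix are \<open>l\<close>.\<close>

lemma (in field) field_trace_square_root:
  assumes K: "subfield K R" and a: "a \<in> carrier R" "a \<notin> K" and sq: "a \<otimes> a \<in> K"
    and k: "k \<in> K" and l: "l \<in> K"
  shows "field_trace K (Span K [a, \<one>]) (k \<otimes> a \<oplus> l) = l \<oplus> l"
proof -
  note Kr = subringE[OF subfieldE(1)[OF K]]
  have c: "k \<in> carrier R" "l \<in> carrier R" using k l subfieldE(3)[OF K] by auto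
  define M where "M i j = (if i = j then l else if i = 0 then k else k \<otimes> (a \<otimes> a))" for i j :: nat
  have MK: "M i j \<in> K" for i j unfolding M_def using k l sq Kr(6) by auto
  have Mc: "M i j \<in> carrier R" for i j using MK subfieldE(3)[OF K] by blast
  have two: "{..<length [a, \<one>]} = {0, 1}" by auto
  have col0: "(k \<otimes> a \<oplus> l) \<otimes> a = l \<otimes> a \<oplus> k \<otimes> (a \<otimes> a) \<otimes> \<one>"
    and col1: "(k \<otimes> a \<oplus> l) \<otimes> \<one> = k \<otimes> a \<oplus> l \<otimes> \<one>"
    using a c by algebra+
  have "(k \<otimes> a \<oplus> l) \<otimes> [a, \<one>] ! j = (\<Oplus>i\<in>{..<length [a, \<one>]}. M i j \<otimes> [a, \<one>] ! i)"
    if "j < length [a, \<one>]" for j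
  proof -
    have "(\<Oplus>i\<in>{..<length [a, \<one>]}. M i j \<otimes> [a, \<one>] ! i) = M 0 j \<otimes> a \<oplus> M 1 j \<otimes> \<one>"
      unfolding two using Mc a by (simp add: finsum_insert Pi_iff)
    moreover have "j = 0 \<or> j = 1" using that by auto
    ultimately show ?thesis unfolding M_def using col0 col1 by auto
  qed
  then have "mult_matrix K (Span K [a, \<one>]) (k \<otimes> a \<oplus> l) [a, \<one>] M"
    unfolding mult_matrix_def using independent_pair[OF K a] MK by blast
  then have "field_trace K (Span K [a, \<one>]) (k \<otimes> a \<oplus> l) = (\<Oplus>i\<in>{..<length [a, \<one>]}. M i i)"
    using a c by (intro field_trace_eq[OF K]) auto
  also have "\<dots> = l \<oplus> l" unfolding two M_def using c by (simp add: finsum_insert Pi_iff)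
  finally show ?thesis .
qed

lemma (in field) trace_zero_set_square_root:
  assumes K: "subfield K R" and a: "a \<in> carrier R" "a \<notin> K" and sq: "a \<otimes> a \<in> K"
    and char: "\<one> \<oplus> \<one> \<noteq> \<zero>"
  shows "{x \<in> Span K [a, \<one>]. field_trace K (Span K [a, \<one>]) x = \<zero>} = (\<lambda>k. k \<otimes> a) ` K"
proof -
  have Kc: "\<And>k. k \<in> K \<Longrightarrow> k \<in> carrier R" using subfieldE(3)[OF K] by blast
  have zero: "\<zero> \<in> K" using subringE(2)[OF subfieldE(1)[OF K]] .
  have l0: "l = \<zero>" if "l \<in> K" "l \<oplus> l = \<zero>" for l
  proof -
    have "l \<oplus> l = (\<one> \<oplus> \<one>) \<otimes> l" using Kc[OF that(1)] by algebra
    then show ?thesis using that Kc[OF that(1)] char integral[of "\<one> \<oplus> \<one>" l] by auto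
  qed
  have "x \<in> (\<lambda>k. k \<otimes> a) ` K"
    if mem: "x \<in> Span K [a, \<one>]" and tr: "field_trace K (Span K [a, \<one>]) x = \<zero>" for x
  proof -
    obtain k l where x: "k \<in> K" "l \<in> K" "x = k \<otimes> a \<oplus> l"
      using mem unfolding Span_pair[OF K a(1)] by blast
    then have "l = \<zero>" using tr field_trace_square_root[OF K a sq] l0 by auto
    then show ?thesis using x Kc a(1) by auto
  qed
  moreover have "k \<otimes> a \<in> Span K [a, \<one>] \<and> field_trace K (Span K [a, \<one>]) (k \<otimes> a) = \<zero>"
    if "k \<in> K" for k
  proof -
    have e: "k \<otimes> a = k \<otimes> a \<oplus> \<zero>" using that Kc a(1) by simp
    have "field_trace K (Span K [a, \<one>]) (k \<otimes> a \<oplus> \<zero>) = \<zero>"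
      using field_trace_square_root[OF K a sq that zero] by simp
    then show ?thesis using e that zero Span_pair[OF K a(1)] by auto
  qed
  ultimately show ?thesis by auto
qed

section \<open>The classification\<close>

text \<open>A counting argument: squaring embeds \<open>A\<close> into its multiplier ring, and multiplication by a
non-zero element of \<open>A\<close> embeds the multiplier ring back into \<open>A\<close>. Hence every multiplier is a
square of an element of \<open>A\<close>, so \<open>1\<close> and \<open>x\<^sup>2 y\<^sup>2\<close> are such squares. Square roots are unique in
characteristic two, so \<open>1\<close> and \<open>x y\<close> themselves belong to \<open>A\<close>.\<close>

lemma (in field) char_2_subfield:
  assumes fin: "finite A" and A: "additive_subgroup A R" "A \<noteq> {\<zero>}"
    and K: "subring (multiplier_ring R A) R"
    and sq: "\<And>a. a \<in> A \<Longrightarrow> a \<otimes> a \<in> multiplier_ring R A"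
    and char: "\<one> \<oplus> \<one> = \<zero>"
  shows "subfield A R"
proof -
  interpret A: additive_subgroup A R by fact
  let ?K = "multiplier_ring R A" and ?sq = "\<lambda>x. x \<otimes> x"
  note Ac = subsetD[OF A.a_subset]
  note Kc = subsetD[OF subringE(1)[OF K]]
  have sq_inj: "x = y" if xy: "x \<in> carrier R" "y \<in> carrier R" "x \<otimes> x = y \<otimes> y" for x y
  proof -
    \<comment> \<open>A form of \<open>(x - y)\<^sup>2\<close> valid in every commutative ring, isolating the multiple of \<open>2\<close>.\<close>
    have "(x \<ominus> y) \<otimes> (x \<ominus> y) = x \<otimes> x \<ominus> y \<otimes> y \<oplus> (\<one> \<oplus> \<one>) \<otimes> (y \<otimes> y \<ominus> x \<otimes> y)"
      using xy(1,2) by algebra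
    also have "\<dots> = \<zero>" unfolding xy(3) char using xy(1,2) by algebra
    finally show ?thesis using xy(1,2) integral by (metis minus_closed r_right_minus_eq)
  qed
  obtain a where a: "a \<in> A" "a \<noteq> \<zero>" using A by fastforce
  have img: "(\<lambda>r. r \<otimes> a) ` ?K \<subseteq> A" using a unfolding multiplier_ring_def by auto
  have inj: "inj_on (\<lambda>r. r \<otimes> a) ?K"
    using m_rcancel[OF a(2) Ac[OF a(1)]] Kc by (auto intro!: inj_onI)
  have finK: "finite ?K" using inj_on_finite[OF inj img fin] .
  have sub: "?sq ` A \<subseteq> ?K" using sq by auto
  have "inj_on ?sq A" using sq_inj Ac by (intro inj_onI) blast
  then have "card (?sq ` A) = card A" by (rule card_image)
  moreover have "card ?K \<le> card A" using card_inj_on_le[OF inj img fin] .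
  ultimately have squares: "?sq ` A = ?K" using card_seteq[OF finK sub] by simp
  have "subring A R"
  proof (rule subringI)
    show "A \<subseteq> carrier R" by (rule A.a_subset)
    have "\<one> \<in> ?sq ` A" unfolding squares using subringE(3)[OF K] .
    then obtain e where e: "e \<in> A" "e \<otimes> e = \<one>" by force
    have "e = \<one>" by (rule sq_inj[OF Ac[OF e(1)] one_closed]) (simp add: e(2))
    then show "\<one> \<in> A" using e(1) by simp
    fix x y assume xy: "x \<in> A" "y \<in> A"
    have "(x \<otimes> x) \<otimes> (y \<otimes> y) \<in> ?sq ` A"
      unfolding squares using sq xy subringE(6)[OF K] by blast
    then obtain z where z: "z \<in> A" "(x \<otimes> x) \<otimes> (y \<otimes> y) = z \<otimes> z" by blast
    have "(x \<otimes> y) \<otimes> (x \<otimes> y) = (x \<otimes> x) \<otimes> (y \<otimes> y)" using xy[THEN Ac] by algebra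
    also note z(2)
    finally have "x \<otimes> y = z" by (rule sq_inj[OF m_closed[OF xy[THEN Ac]] Ac[OF z(1)]])
    then show "x \<otimes> y \<in> A" using z by simp
  qed auto
  then show ?thesis using finite_subring_is_subfield fin by blast
qed

text \<open>Since \<open>2 x y = (x + y)\<^sup>2 - x\<^sup>2 - y\<^sup>2\<close> and \<open>2\<close> is invertible in the field of multipliers, all
products of two elements of \<open>A\<close> are multipliers; apply this to \<open>x\<close> and \<open>a\<^sup>-\<^sup>1\<close>.\<close>

lemma (in field) odd_char_coset:
  assumes A: "additive_subgroup A R" and ic: "inverse_closed R A"
    and K: "subfield (multiplier_ring R A) R"
    and sq: "\<And>a. a \<in> A \<Longrightarrow> a \<otimes> a \<in> multiplier_ring R A"
    and char: "\<one> \<oplus> \<one> \<noteq> \<zero>" and a: "a \<in> A" "a \<noteq> \<zero>"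
  shows "A = (\<lambda>k. k \<otimes> a) ` multiplier_ring R A"
proof -
  interpret A: additive_subgroup A R by fact
  let ?K = "multiplier_ring R A"
  note Ac = subsetD[OF A.a_subset]
  note Kr = subringE[OF subfieldE(1)[OF K]]
  have two: "\<one> \<oplus> \<one> \<in> ?K" using Kr(3,7) by blast
  have tU: "\<one> \<oplus> \<one> \<in> Units R" using char field_Units by auto
  have half: "inv (\<one> \<oplus> \<one>) \<in> ?K" using subfield_m_inv(1)[OF K] two char by blast
  have prod: "x \<otimes> y \<in> ?K" if xy: "x \<in> A" "y \<in> A" for x y
  proof -
    note c = xy[THEN Ac]
    have "(x \<oplus> y) \<otimes> (x \<oplus> y) \<oplus> \<ominus> (x \<otimes> x) \<oplus> \<ominus> (y \<otimes> y) \<in> ?K"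
      using sq xy Kr(5,7) by simp
    moreover have "(x \<oplus> y) \<otimes> (x \<oplus> y) \<oplus> \<ominus> (x \<otimes> x) \<oplus> \<ominus> (y \<otimes> y) = (\<one> \<oplus> \<one>) \<otimes> (x \<otimes> y)"
      using c by algebra
    ultimately have "inv (\<one> \<oplus> \<one>) \<otimes> ((\<one> \<oplus> \<one>) \<otimes> (x \<otimes> y)) \<in> ?K" using half Kr(6) by simp
    then show ?thesis using c tU by (simp add: m_assoc[symmetric])
  qed
  have ia: "inv a \<in> A" using ic a unfolding inverse_closed_def by blast
  have "x \<in> (\<lambda>k. k \<otimes> a) ` ?K" if x: "x \<in> A" for x
  proof
    show "x \<otimes> inv a \<in> ?K" using prod x ia by blast
    have "a \<in> Units R" using a Ac field_Units by auto
    then show "x = x \<otimes> inv a \<otimes> a" using Ac[OF x] Ac[OF a(1)] by (simp add: m_assoc)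
  qed
  then show ?thesis using a unfolding multiplier_ring_def by auto
qed

theorem theorem3:
  fixes E :: "('a, 'b) ring_scheme" and A :: "'a set"
  assumes "field E" and "finite (carrier E)"
    and "additive_subgroup A E" and "A \<noteq> {\<zero>\<^bsub>E\<^esub>}"
    and "inverse_closed E A"
  shows "subfield A E \<or>
    (\<exists>K L. subfield K E \<and> subfield L E \<and> K \<subseteq> L \<and> ring.dimension E 2 K L \<and>
           A = {x \<in> L. ring.field_trace E K L x = \<zero>\<^bsub>E\<^esub>})"
proof -
  interpret field E by fact
  interpret A: additive_subgroup A E by fact
  let ?K = "multiplier_ring E A"
  have fin: "finite H" if "H \<subseteq> carrier E" for H using finite_subset[OF that] assms(2) .
  have Kr: "subring ?K E" using subring_multiplier_ring assms(3) .
  have K: "subfield ?K E" using finite_subring_is_subfield[OF Kr fin[OF subringE(1)[OF Kr]]] .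
  have sq: "\<And>a. a \<in> A \<Longrightarrow> a \<otimes>\<^bsub>E\<^esub> a \<in> ?K"
    using inverse_closed_square_multiplies assms(3,5) .
  show ?thesis
  proof (cases "\<one>\<^bsub>E\<^esub> \<oplus>\<^bsub>E\<^esub> \<one>\<^bsub>E\<^esub> = \<zero>\<^bsub>E\<^esub>")
    case True
    then show ?thesis using char_2_subfield[OF fin[OF A.a_subset] assms(3,4) Kr sq] by blast
  next
    case False
    obtain a where a: "a \<in> A" "a \<noteq> \<zero>\<^bsub>E\<^esub>" using assms(4) A.zero_closed by blast
    have ac: "a \<in> carrier E" using a A.a_subset by blast
    have A_eq: "A = (\<lambda>k. k \<otimes>\<^bsub>E\<^esub> a) ` ?K" using odd_char_coset[OF assms(3,5) K sq False a] .
    show ?thesis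
    proof (cases "a \<in> ?K")
      case True
      have "x \<in> A" if x: "x \<in> ?K" for x
      proof -
        have "inv\<^bsub>E\<^esub> a \<in> ?K" using subfield_m_inv(1)[OF K] True a by blast
        then have "x \<otimes>\<^bsub>E\<^esub> inv\<^bsub>E\<^esub> a \<otimes>\<^bsub>E\<^esub> a \<in> A"
          using subringE(6)[OF Kr x] A_eq by blast
        moreover have "a \<in> Units E" "x \<in> carrier E"
          using a ac field_Units subringE(1)[OF Kr] x by auto
        ultimately show ?thesis using ac by (simp add: m_assoc)
      qed
      moreover have "x \<in> ?K" if x: "x \<in> A" for x
      proof -
        have "x \<in> (\<lambda>k. k \<otimes>\<^bsub>E\<^esub> a) ` ?K" using x A_eq by simp
        then obtain k where "k \<in> ?K" "x = k \<otimes>\<^bsub>E\<^esub> a" by blast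
        then show ?thesis using subringE(6)[OF Kr _ True] by simp
      qed
      ultimately have "A = ?K" by blast
      then show ?thesis using K by simp
    next
      case nK: False
      let ?L = "Span ?K [a, \<one>\<^bsub>E\<^esub>]"
      have ind: "independent ?K [a, \<one>\<^bsub>E\<^esub>]" using independent_pair[OF K ac nK] .
      have Lr: "subring ?L E" using subring_Span_square_root[OF K ac sq[OF a(1)]] .
      have L: "subfield ?L E"
        using finite_subring_is_subfield[OF Lr fin[OF subringE(1)[OF Lr]]] .
      have "k \<in> ?L" if k: "k \<in> ?K" for k
      proof -
        have "k = \<zero>\<^bsub>E\<^esub> \<otimes>\<^bsub>E\<^esub> a \<oplus>\<^bsub>E\<^esub> k" using ac k subringE(1)[OF Kr] by auto
        then show ?thesis using Span_pair[OF K ac] k subringE(2)[OF Kr] by blast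
      qed
      then have KL: "?K \<subseteq> ?L" by blast
      have dim: "dimension 2 ?K ?L" using dimension_independent[OF ind] by (simp add: numeral_2_eq_2)
      have "A = {x \<in> ?L. field_trace ?K ?L x = \<zero>\<^bsub>E\<^esub>}"
        using A_eq trace_zero_set_square_root[OF K ac nK sq[OF a(1)] False] by simp
      then show ?thesis using K L KL dim by blast
    qed
  qed
qed

end
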